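(* Let $\lambda$ be a nonzero real number and let $n,r$ be positive integers. Then $$HF_{n,\lambda}^{(r)}(y)=\sum_{k=1}^{n}H_{k,\lambda}^{(r)}\,y^{k}\,k!{n \brace k}_{\lambda}=\sum_{k=1}^{n}\frac{\binom{k+r-1}{r-1}}{\binom{r-1-\lambda}{r-1}}\big(H_{k+r-1,\lambda}-H_{r-1,\lambda}\big)k!{n \brace k}_{\lambda}y^{k}.$$ In particular, for $y=1$, $$HF_{n,\lambda}^{(r)}=\sum_{k=1}^{n}H_{k,\lambda}^{(r)}k!{n \brace k}_{\lambda}=\sum_{k=1}^{n}\frac{\binom{k+r-1}{r-1}}{\binom{r-1-\lambda}{r-1}}\big(H_{k+r-1,\lambda}-H_{r-1,\lambda}\big)k!{n \brace k}_{\lambda}.$$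
   Context: Fix a nonzero real $\lambda$. For real $a$ and integer $j\ge0$, $\binom{a}{j}=\frac{a(a-1)\cdots(a-j+1)}{j!}$. Notation: $(x)_{0,\lambda}=1$ and $(x)_{n,\lambda}=x(x-\lambda)\cdots(x-(n-1)\lambda)$ for $n\ge1$; $(x)_0=1$ and $(x)_n=x(x-1)\cdots(x-n+1)$ for $n\ge 1$. Degenerate logarithm: $\log_{\lambda}(1+t)=\frac{1}{\lambda}\big((1+t)^{\lambda}-1\big)$, expanded as a power series in $t$. Degenerate exponential: $e_{\lambda}(t)=(1+\lambda t)^{1/\lambda}=\sum_{n\ge0}(1)_{n,\lambda}\frac{t^{n}}{n!}$. Degenerate Stirling numbers of the second kind ${n\brace k}_{\lambda}$: defined by $(x)_{n,\lambda}=\sum_{k=0}^{n}{n \brace k}_{\lambda}(x)_{k}$, $n\ge0$. Degenerate harmonic numbers $H_{n,\lambda}$: $H_{0,\lambda}=0$ and $-\frac{\log_{\lambda}(1-t)}{1-t}=\sum_{n=1}^{\infty}H_{n,\lambda}t^{n}$. Degenerate hyperharmonic numbers: $H_{0,\lambda}^{(r)}=0$ $(r\ge1)$, $H_{n,\lambda}^{(1)}=H_{n,\lambda}$, and $H_{n,\lambda}^{(r)}=\sum_{k=1}^{n}H_{k,\lambda}^{(r-1)}$ for $r\ge2$, $n\ge1$; their generating function is $-\frac{\log_{\lambda}(1-t)}{(1-t)^{r}}=\sum_{n=1}^{\infty}H_{n,\lambda}^{(r)}t^{n}$. Degenerate hyperharmonic-Fubini polynomials $HF_{n,\lambda}^{(r)}(y)$,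 for $r$ a positive integer: defined by $$-\frac{\log_{\lambda}\big(1-y(e_{\lambda}(t)-1)\big)}{\big(1-y(e_{\lambda}(t)-1)\big)^{r}}=\sum_{n=1}^{\infty}HF_{n,\lambda}^{(r)}(y)\frac{t^{n}}{n!}.$$ Degenerate hyperharmonic-Fubini numbers: $HF_{n,\lambda}^{(r)}=HF_{n,\lambda}^{(r)}(1)$.
   Formalization: The second equality of each chain is stated only when the denominator binom(r-1-λ, r-1) is nonzero, i.e. λ not in {1,...,r-1}; otherwise the last expression divides by zero. The first equalities hold for every nonzero λ. *)

theory Defs
  imports Complex_Main "HOL-Computational_Algebra.Formal_Power_Series"
begin

definition falling :: "real \<Rightarrow> nat \<Rightarrow> real" where
  "falling x n = (\<Prod>i<n. x - real i)"

definition deg_falling :: "real \<Rightarrow> real \<Rightarrow> nat \<Rightarrow> real" where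
  "deg_falling lam x n = (\<Prod>i<n. x - real i * lam)"

text \<open>The series of \<open>log\<^sub>\<lambda>(1 + t) = ((1 + t)\<^sup>\<lambda> - 1) / \<lambda>\<close>; the argument of the
  logarithm is shifted, so \<open>log\<^sub>\<lambda>(1 - u)\<close> is \<open>deg_log1p lam oo (- u)\<close> for a series \<open>u\<close>
  without constant term.\<close>

definition deg_log1p :: "real \<Rightarrow> real fps" where
  "deg_log1p lam = fps_const (1 / lam) * (fps_binomial lam - 1)"

text \<open>\<open>e\<^sub>\<lambda>(t) = (1 + \<lambda> t) powr (1 / \<lambda>)\<close> as a formal power series.\<close>

definition deg_exp :: "real \<Rightarrow> real fps" where
  "deg_exp lam = fps_binomial (1 / lam) oo (fps_const lam * fps_X)"

lemma deg_exp_nth: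
  assumes "lam \<noteq> 0"
  shows "fps_nth (deg_exp lam) n = deg_falling lam 1 n / fact n"
proof -
  have "lam ^ n * (\<Prod>i<n. 1 / lam - real i) = (\<Prod>i<n. lam * (1 / lam - real i))"
    by (simp add: prod.distrib)
  also have "\<dots> = (\<Prod>i<n. 1 - real i * lam)"
    using assms by (intro prod.cong) (auto simp: field_simps)
  finally show ?thesis
    by (simp add: deg_exp_def fps_compose_linear deg_falling_def gbinomial_prod_rev
        lessThan_atLeast0)
qed

text \<open>The coefficients of the expansion of \<open>deg_falling lam x n\<close> in the basis of falling
  factorials, as a function of the index, extended by \<open>0\<close> beyond \<open>n\<close>. The lemma
  \<open>ex1_falling_expansion\<close> below shows that the description is proper.\<close>

definition deg_Stirling2 :: "real \<Rightarrow> nat \<Rightarrow> nat \<Rightarrow> real" where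
  "deg_Stirling2 lam n =
     (THE c. (\<forall>k>n. c k = 0) \<and> (\<forall>x. deg_falling lam x n = (\<Sum>k\<le>n. c k * falling x k)))"

lemma falling_of_nat_less: "m < k \<Longrightarrow> falling (real m) k = 0"
  by (auto simp: falling_def)

lemma falling_of_nat_self: "falling (real m) m \<noteq> 0"
  by (auto simp: falling_def)

lemma falling_expansion_zero:
  assumes "\<And>x. (\<Sum>k\<le>n. d k * falling x k) = 0" and "m \<le> n"
  shows "d m = 0"
  using \<open>m \<le> n\<close>
proof (induction m rule: less_induct)
  case (less m)
  have "(\<Sum>k\<le>n. d k * falling (real m) k) = (\<Sum>k\<in>{m}. d k * falling (real m) k)"
  proof (rule sum.mono_neutral_right)
    show "\<forall>i\<in>{..n} - {m}. d i * falling (real m) i = 0"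
    proof
      fix i assume "i \<in> {..n} - {m}"
      then consider "i < m" | "m < i" by fastforce
      then show "d i * falling (real m) i = 0"
        using less by cases (auto simp: falling_of_nat_less)
    qed
  qed (use less in auto)
  with assms(1)[of "real m"] falling_of_nat_self[of m] show ?case by simp
qed

lemma ex_falling_expansion:
  "\<exists>c. (\<forall>k>n. c k = 0) \<and> (\<forall>x. deg_falling lam x n = (\<Sum>k\<le>n. c k * falling x k))"
proof (induction n)
  case 0
  show ?case
    by (rule exI[of _ "\<lambda>k. if k = 0 then 1 else 0"]) (simp add: falling_def deg_falling_def)
next
  case (Suc n)
  then obtain c where c0: "\<And>k. k > n \<Longrightarrow> c k = 0"
    and c: "\<And>x. deg_falling lam x n = (\<Sum>k\<le>n. c k * falling x k)" by blast
  define d where "d k = (if k = 0 then 0 else c (k - 1)) + (real k - real n * lam) * c k" for k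
  have "deg_falling lam x (Suc n) = (\<Sum>k\<le>Suc n. d k * falling x k)" for x
  proof -
    have "deg_falling lam x (Suc n) = (\<Sum>k\<le>n. c k * falling x k) * (x - real n * lam)"
      by (simp add: c[symmetric]) (simp add: deg_falling_def)
    also have "\<dots> = (\<Sum>k\<le>n. c k * falling x (Suc k)
        + (real k - real n * lam) * c k * falling x k)"
      unfolding sum_distrib_right
      by (rule sum.cong) (simp_all add: falling_def algebra_simps)
    also have "\<dots> = (\<Sum>k\<le>n. c k * falling x (Suc k))
        + (\<Sum>k\<le>Suc n. (real k - real n * lam) * c k * falling x k)"
      by (simp add: sum.distrib c0)
    also have "(\<Sum>k\<le>n. c k * falling x (Suc k))
        = (\<Sum>k\<le>Suc n. (if k = 0 then 0 else c (k - 1)) * falling x k)"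
      by (subst sum.atMost_Suc_shift) simp
    finally show ?thesis
      unfolding d_def sum.distrib[symmetric] by (simp add: distrib_right)
  qed
  moreover have "\<forall>k>Suc n. d k = 0" by (auto simp: d_def c0)
  ultimately show ?case by blast
qed

lemma ex1_falling_expansion:
  "\<exists>!c. (\<forall>k>n. c k = 0) \<and> (\<forall>x. deg_falling lam x n = (\<Sum>k\<le>n. c k * falling x k))"
proof (rule ex_ex1I[OF ex_falling_expansion])
  fix c d :: "nat \<Rightarrow> real"
  assume c: "(\<forall>k>n. c k = 0) \<and> (\<forall>x. deg_falling lam x n = (\<Sum>k\<le>n. c k * falling x k))"
    and d: "(\<forall>k>n. d k = 0) \<and> (\<forall>x. deg_falling lam x n = (\<Sum>k\<le>n. d k * falling x k))"
  have "(\<Sum>k\<le>n. (c k - d k) * falling x k) = 0" for x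
    using c d by (simp add: left_diff_distrib sum_subtractf)
  then have "c k = d k" if "k \<le> n" for k
    using falling_expansion_zero[of "\<lambda>k. c k - d k" n] that by simp
  then show "c = d" using c d by (metis ext not_le)
qed

lemma deg_falling_eq_sum_deg_Stirling2:
  "deg_falling lam x n = (\<Sum>k\<le>n. deg_Stirling2 lam n k * falling x k)"
  using theI'[OF ex1_falling_expansion[of n lam]] unfolding deg_Stirling2_def by blast

definition deg_harmonic :: "real \<Rightarrow> nat \<Rightarrow> real" where
  "deg_harmonic lam n = fps_nth (- (deg_log1p lam oo (- fps_X)) / (1 - fps_X)) n"

text \<open>The order \<open>r\<close> is the second argument; order \<open>0\<close> is not meaningful and left unspecified.\<close>

fun deg_hyperharmonic :: "real \<Rightarrow> nat \<Rightarrow> nat \<Rightarrow> real" where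
  "deg_hyperharmonic lam (Suc 0) n = deg_harmonic lam n"
| "deg_hyperharmonic lam (Suc (Suc r)) n = (\<Sum>k=1..n. deg_hyperharmonic lam (Suc r) k)"

lemma deg_harmonic_0: "deg_harmonic lam 0 = 0"
  by (simp add: deg_harmonic_def deg_log1p_def fps_divide_unit)

lemma deg_hyperharmonic_0: "r \<ge> 1 \<Longrightarrow> deg_hyperharmonic lam r 0 = 0"
  by (cases "(lam, r, 0::nat)" rule: deg_hyperharmonic.cases) (auto simp: deg_harmonic_0)

definition deg_hyperharmonic_Fubini_poly :: "real \<Rightarrow> nat \<Rightarrow> nat \<Rightarrow> real \<Rightarrow> real" where
  "deg_hyperharmonic_Fubini_poly lam r n y =
     (let u = fps_const y * (deg_exp lam - 1)
      in fact n * fps_nth (- (deg_log1p lam oo (- u)) / (1 - u) ^ r) n)"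

definition deg_hyperharmonic_Fubini :: "real \<Rightarrow> nat \<Rightarrow> nat \<Rightarrow> real" where
  "deg_hyperharmonic_Fubini lam r n = deg_hyperharmonic_Fubini_poly lam r n 1"

lemma deg_hyperharmonic_Fubini_poly_0: "deg_hyperharmonic_Fubini_poly lam r 0 y = 0"
  by (simp add: deg_hyperharmonic_Fubini_poly_def deg_log1p_def deg_exp_def fps_divide_unit)

end

theory Submission
  imports Defs
begin

text \<open>
  The generating function of the Fubini polynomials is that of the hyperharmonic numbers,
  \<open>- log\<^sub>\<lambda>(1 - X) / (1 - X) ^ r\<close>, with \<open>y (e\<^sub>\<lambda>(t) - 1)\<close> substituted for \<open>X\<close>
  (\<open>fps_deg_hyperharmonic\<close>, \<open>deg_hyperharmonic_series_compose\<close>). The first formula therefore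
  amounts to knowing the coefficients of \<open>(e\<^sub>\<lambda>(t) - 1) ^ k\<close>. These are
  \<open>k! / n!\<close> times the degenerate Stirling numbers (\<open>deg_exp_minus_1_power_nth\<close>): for a natural
  number \<open>m\<close>, the binomial theorem expands \<open>e\<^sub>\<lambda>(t) ^ m = (1 + (e\<^sub>\<lambda>(t) - 1)) ^ m\<close>, whose
  coefficients are \<open>deg_falling \<lambda> m n / n!\<close>, in terms of \<open>m choose k\<close>, that is, in falling
  factorials of \<open>m\<close>; and the coefficients of such an expansion are determined by its values at
  the natural numbers.

  The second formula holds term by term and concerns hyperharmonic numbers only. Since
  \<open>(1 - t) d/dt (1 - t)\<^sup>\<lambda> = - \<lambda> (1 - t)\<^sup>\<lambda>\<close>, the degenerate harmonic numbers satisfy the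
  first-order recurrence \<open>(n + 1) (H (n + 1) - H n) = 1 - \<lambda> H n\<close> (\<open>deg_harmonic_Suc\<close>), where
  \<open>\<lambda> = 0\<close> would give the classical one. With it, the claimed closed form is seen to
  have the right differences in \<open>k\<close>, and induction on the order gives
  \<open>deg_hyperharmonic_closed_form\<close>. There both sides are multiplied by
  \<open>r - 1 - \<lambda> gchoose (r - 1)\<close>, so that the induction runs through all orders even where this
  factor vanishes.
\<close>

section \<open>Powers of the degenerate exponential\<close>

lemma deg_exp_power_nth:
  assumes "lam \<noteq> 0"
  shows "fps_nth (deg_exp lam ^ m) n = deg_falling lam (real m) n / fact n"
proof -
  have "deg_exp lam ^ m = fps_binomial (real m / lam) oo (fps_const lam * fps_X)"
    by (simp add: deg_exp_def fps_compose_power fps_binomial_power)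
  moreover have "lam ^ n * (\<Prod>i<n. real m / lam - real i) = deg_falling lam (real m) n"
  proof -
    have "lam ^ n * (\<Prod>i<n. real m / lam - real i) = (\<Prod>i<n. lam * (real m / lam - real i))"
      by (simp add: prod.distrib)
    also have "\<dots> = deg_falling lam (real m) n"
      unfolding deg_falling_def using assms by (intro prod.cong) (auto simp: field_simps)
    finally show ?thesis .
  qed
  ultimately show ?thesis
    by (simp add: fps_compose_linear gbinomial_prod_rev lessThan_atLeast0)
qed

lemma falling_of_nat_eq: "falling (real m) k = fact k * real (m choose k)"
  by (simp add: falling_def binomial_gbinomial gbinomial_prod_rev lessThan_atLeast0)

text \<open>Evaluating at \<open>m\<close> removes the terms beyond \<open>m\<close>, so the values at \<open>0, \<dots>, n\<close> form a
  triangular system for the coefficients.\<close>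

lemma falling_expansion_unique:
  assumes eq: "\<And>m. (\<Sum>k\<le>n. c k * falling (real m) k) = (\<Sum>k\<le>n. d k * falling (real m) k)"
    and "m \<le> n"
  shows "c m = d m"
  using \<open>m \<le> n\<close>
proof (induction m rule: less_induct)
  case (less m)
  have "(\<Sum>k\<le>n. (c k - d k) * falling (real m) k)
      = (\<Sum>k\<in>{m}. (c k - d k) * falling (real m) k)"
  proof (rule sum.mono_neutral_right)
    show "\<forall>i\<in>{..n} - {m}. (c i - d i) * falling (real m) i = 0"
    proof
      fix i assume "i \<in> {..n} - {m}"
      then consider "i < m" "i \<le> n" | "m < i" by fastforce
      then show "(c i - d i) * falling (real m) i = 0"
        using less.IH by cases (auto simp: falling_of_nat_less)
    qed
  qed (use less.prems in auto)
  moreover have "(\<Sum>k\<le>n. (c k - d k) * falling (real m) k) = 0"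
    using eq[of m] by (simp add: left_diff_distrib sum_subtractf)
  ultimately show ?case
    using falling_of_nat_self[of m] by simp
qed

lemma deg_exp_minus_1_nth_0: "fps_nth (deg_exp lam - 1) 0 = 0"
  by (simp add: deg_exp_def)

text \<open>Expanding \<open>(1 + F) ^ m\<close> with \<open>F = e\<^sub>\<lambda>(t) - 1\<close> by the binomial theorem yields the
  defining expansion of the Stirling numbers at each natural number \<open>m\<close>.\<close>

lemma deg_exp_minus_1_power_nth:
  assumes "lam \<noteq> 0" and "k \<le> n"
  shows "fps_nth ((deg_exp lam - 1) ^ k) n = fact k / fact n * deg_Stirling2 lam n k"
proof -
  let ?F = "deg_exp lam - 1"
  define w where "w k = fact n / fact k * fps_nth (?F ^ k) n" for k
  have "(\<Sum>k\<le>n. w k * falling (real m) k)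
      = (\<Sum>k\<le>n. deg_Stirling2 lam n k * falling (real m) k)" for m
  proof -
    have "deg_falling lam (real m) n / fact n = fps_nth ((?F + 1) ^ m) n"
      by (simp add: deg_exp_power_nth[OF assms(1)])
    also have "\<dots> = (\<Sum>k\<le>m. real (m choose k) * fps_nth (?F ^ k) n)"
      by (simp only: binomial_ring fps_sum_nth power_one mult_1_right fps_mult_left_const_nth
          flip: fps_of_nat)
    also have "\<dots> = (\<Sum>k\<le>m + n. real (m choose k) * fps_nth (?F ^ k) n)"
      by (rule sum.mono_neutral_left) auto
    also have "\<dots> = (\<Sum>k\<le>n. real (m choose k) * fps_nth (?F ^ k) n)"
      using startsby_zero_power_prefix[OF deg_exp_minus_1_nth_0[of lam]]
      by (intro sum.mono_neutral_right) auto
    finally have "deg_falling lam (real m) n = (\<Sum>k\<le>n. w k * falling (real m) k)"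
      by (simp add: w_def falling_of_nat_eq sum_distrib_left field_simps)
    then show ?thesis
      by (simp add: deg_falling_eq_sum_deg_Stirling2)
  qed
  then have "deg_Stirling2 lam n k = w k"
    using assms(2) by (metis falling_expansion_unique)
  then show ?thesis
    by (simp add: w_def)
qed

section \<open>The generating function of the hyperharmonic numbers\<close>

lemma fps_deg_hyperharmonic:
  "Abs_fps (deg_hyperharmonic lam (Suc s)) =
     - (deg_log1p lam oo (- fps_X)) / (1 - fps_X) ^ Suc s"
proof (induction s)
  case 0
  show ?case by (simp add: fps_eq_iff deg_harmonic_def)
next
  case (Suc s)
  have "Abs_fps (deg_hyperharmonic lam (Suc (Suc s)))
      = Abs_fps (deg_hyperharmonic lam (Suc s)) / (1 - fps_X)"
    by (simp add: fps_divide_fps_X_minus1_sum fps_eq_iff sum.atLeast_Suc_atMost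
        deg_hyperharmonic_0)
  then show ?case
    by (simp add: Suc fps_divide_unit fps_inverse_mult mult_ac del: deg_hyperharmonic.simps)
qed

lemma deg_hyperharmonic_series_compose:
  fixes u :: "real fps"
  assumes "fps_nth u 0 = 0"
  shows "Abs_fps (deg_hyperharmonic lam (Suc s)) oo u =
     - (deg_log1p lam oo (- u)) / (1 - u) ^ Suc s"
proof -
  have X: "fps_X oo u = u" using assms by (rule fps_X_fps_compose_startby0)
  have "(deg_log1p lam oo (- fps_X)) oo u = deg_log1p lam oo (- u)"
    using assms by (simp add: fps_compose_uminus X flip: fps_compose_assoc)
  moreover have "((1 - fps_X) ^ Suc s) oo u = (1 - u) ^ Suc s"
    using assms by (simp only: fps_compose_power[symmetric] fps_compose_sub_distrib X fps_compose_1)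
  moreover have "fps_nth ((1 - fps_X :: real fps) ^ Suc s) 0 \<noteq> 0" by simp
  ultimately show ?thesis
    using assms
    by (simp add: fps_deg_hyperharmonic fps_divide_compose fps_compose_uminus del: power_Suc)
qed

text \<open>The sum starts at \<open>1\<close> because the hyperharmonic series has no constant term.\<close>

lemma deg_hyperharmonic_Fubini_poly_eq_sum:
  assumes "lam \<noteq> 0" and "r \<ge> 1"
  shows "deg_hyperharmonic_Fubini_poly lam r n y =
     (\<Sum>k=1..n. deg_hyperharmonic lam r k * y ^ k * fact k * deg_Stirling2 lam n k)"
proof -
  obtain s where r: "r = Suc s" using assms(2) by (cases r) auto
  define u where "u = fps_const y * (deg_exp lam - 1)"
  have u0: "fps_nth u 0 = 0" by (simp add: u_def deg_exp_def)
  have u: "fps_nth (u ^ k) n = y ^ k * (fact k / fact n * deg_Stirling2 lam n k)"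
    if "k \<le> n" for k
    using that by (simp add: u_def power_mult_distrib fps_const_power
        deg_exp_minus_1_power_nth[OF assms(1)])
  have "deg_hyperharmonic_Fubini_poly lam r n y
      = fact n * fps_nth (Abs_fps (deg_hyperharmonic lam r) oo u) n"
    by (simp add: deg_hyperharmonic_Fubini_poly_def Let_def r
        deg_hyperharmonic_series_compose[OF u0] flip: u_def del: power_Suc)
  also have "\<dots> = (\<Sum>k=0..n. deg_hyperharmonic lam r k * y ^ k * fact k * deg_Stirling2 lam n k)"
    unfolding fps_compose_nth sum_distrib_left by (rule sum.cong) (simp_all add: u)
  also have "\<dots> = (\<Sum>k=1..n. deg_hyperharmonic lam r k * y ^ k * fact k * deg_Stirling2 lam n k)"
    using assms(2) by (simp add: sum.atLeast_Suc_atMost deg_hyperharmonic_0)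
  finally show ?thesis .
qed

section \<open>The closed form of the hyperharmonic numbers\<close>

lemma deg_harmonic_eq_sum:
  "deg_harmonic lam n = (\<Sum>i\<le>n. - ((-1) ^ i * fps_nth (deg_log1p lam) i))"
  by (simp add: deg_harmonic_def fps_divide_fps_X_minus1_sum fps_compose_uminus'
      atMost_atLeast0)

text \<open>The absorption identity for \<open>\<lambda> gchoose n\<close> relates consecutive increments
  \<open>d n = H n - H (n - 1)\<close> by \<open>(n + 1) d (n + 1) = (n - \<lambda>) d n\<close> for \<open>n \<ge> 1\<close>, which telescopes.\<close>

lemma deg_harmonic_Suc:
  assumes "lam \<noteq> 0"
  shows "real (Suc n) * (deg_harmonic lam (Suc n) - deg_harmonic lam n)
    = 1 - lam * deg_harmonic lam n"
proof (induction n)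
  case 0
  show ?case using assms by (simp add: deg_harmonic_eq_sum deg_log1p_def)
next
  case (Suc n)
  define g where "g = (-1) ^ n * (lam gchoose Suc n) / lam"
  have d1: "deg_harmonic lam (Suc n) - deg_harmonic lam n = g"
    by (simp add: deg_harmonic_eq_sum deg_log1p_def g_def)
  have "deg_harmonic lam (Suc (Suc n)) - deg_harmonic lam (Suc n)
      = - ((-1) ^ n * (lam gchoose Suc (Suc n)) / lam)"
    by (simp add: deg_harmonic_eq_sum deg_log1p_def)
  moreover have "real (Suc (Suc n)) * (lam gchoose Suc (Suc n))
      = (lam - real (Suc n)) * (lam gchoose Suc n)"
    using gbinomial_mult_1[of lam "Suc n"] by (simp add: algebra_simps)
  ultimately have "real (Suc (Suc n)) * (deg_harmonic lam (Suc (Suc n)) - deg_harmonic lam (Suc n))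
      = (real (Suc n) - lam) * g"
    by (simp add: g_def mult.left_commute[of "real (Suc (Suc n))"] del: of_nat_Suc)
      (simp add: algebra_simps diff_divide_distrib add_divide_distrib)
  also have "\<dots> = (1 - lam * deg_harmonic lam n) - lam * g"
    using Suc unfolding d1 by (simp add: algebra_simps)
  finally show ?case
    using d1 by (simp add: algebra_simps)
qed

lemma deg_hyperharmonic_Suc_Suc:
  "deg_hyperharmonic lam (Suc (Suc r)) (Suc k)
     = deg_hyperharmonic lam (Suc (Suc r)) k + deg_hyperharmonic lam (Suc r) (Suc k)"
  by simp

text \<open>The induction on the order contains one on \<open>k\<close>, that is, a comparison of differences. With
  \<open>N = k + s + 1\<close>, absorption turns \<open>N + 1 choose (s + 1)\<close> into a multiple of
  \<open>N choose s\<close>; what remains is the difference of the recurrences for \<open>H (N + 1)\<close> and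
  \<open>H (s + 1)\<close>.\<close>

lemma deg_hyperharmonic_closed_form:
  assumes "lam \<noteq> 0"
  shows "((real s - lam) gchoose s) * deg_hyperharmonic lam (Suc s) k
    = real ((k + s) choose s) * (deg_harmonic lam (k + s) - deg_harmonic lam s)"
proof (induction s arbitrary: k)
  case 0
  show ?case by (simp add: deg_harmonic_0)
next
  case (Suc s)
  define H where "H = deg_harmonic lam"
  have G: "((real (Suc s) - lam) gchoose Suc s)
      = (real (Suc s) - lam) / real (Suc s) * ((real s - lam) gchoose s)"
    using gbinomial_factors[of "real s - lam" s] by (simp add: algebra_simps)
  show ?case
  proof (induction k)
    case 0
    show ?case by (simp add: deg_hyperharmonic_0)
  next
    case (Suc k)
    define N where "N = k + Suc s"
    define b where "b = real (N choose s)"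
    have absorb: "real (Suc s) * real (Suc N choose Suc s) = real (Suc N) * b"
      unfolding b_def using Suc_times_binomial[of s N] by (metis of_nat_mult)
    have pascal: "real (Suc N choose Suc s) = b + real (N choose Suc s)"
      by (simp add: b_def)
    have IH_s: "((real s - lam) gchoose s) * deg_hyperharmonic lam (Suc s) (Suc k) = b * (H N - H s)"
      using \<open>\<And>k. _ = real ((k + s) choose s) * _\<close>[of "Suc k"] by (simp add: b_def N_def H_def)
    have IH_k: "((real (Suc s) - lam) gchoose Suc s) * deg_hyperharmonic lam (Suc (Suc s)) k
        = real (N choose Suc s) * (H N - H (Suc s))"
      using Suc by (simp add: N_def H_def)
    have "real (Suc s) * (real (Suc N choose Suc s) * (H (Suc N) - H N))
        = b * (real (Suc N) * (H (Suc N) - H N))"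
      using absorb by (metis mult.assoc mult.commute)
    also have "\<dots> = b * (1 - lam * H N)"
      by (simp only: H_def deg_harmonic_Suc[OF assms])
    finally have step: "real (Suc s) * (real (Suc N choose Suc s) * (H (Suc N) - H N))
        = b * (1 - lam * H N)" .
    have step_s: "real (Suc s) * (H (Suc s) - H s) = 1 - lam * H s"
      by (simp only: H_def deg_harmonic_Suc[OF assms])
    have "real (Suc s) * (((real (Suc s) - lam) gchoose Suc s)
          * deg_hyperharmonic lam (Suc s) (Suc k))
        = (real (Suc s) - lam) * (b * (H N - H s))"
      by (simp add: G flip: IH_s del: of_nat_Suc)
    also have "\<dots> = b * (real (Suc s) * (H N - H s)) - b * (1 - lam * H s) + b * (1 - lam * H N)"
      by (simp add: algebra_simps)
    also have "\<dots> = real (Suc s) * (b * (H N - H (Suc s))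
        + real (Suc N choose Suc s) * (H (Suc N) - H N))"
      unfolding step[symmetric] step_s[symmetric] by (simp only: algebra_simps)
    finally have "((real (Suc s) - lam) gchoose Suc s) * deg_hyperharmonic lam (Suc s) (Suc k)
        = b * (H N - H (Suc s)) + real (Suc N choose Suc s) * (H (Suc N) - H N)"
      by (simp only: mult_cancel_left of_nat_eq_0_iff) simp
    then have "((real (Suc s) - lam) gchoose Suc s) * deg_hyperharmonic lam (Suc (Suc s)) (Suc k)
        = real (N choose Suc s) * (H N - H (Suc s)) + b * (H N - H (Suc s))
          + real (Suc N choose Suc s) * (H (Suc N) - H N)"
      using IH_k by (simp only: deg_hyperharmonic_Suc_Suc distrib_left add.assoc)
    also have "\<dots> = real (Suc N choose Suc s) * (H (Suc N) - H (Suc s))"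
      unfolding pascal by (simp only: algebra_simps)
    finally show ?case
      by (simp only: N_def H_def add_Suc)
  qed
qed

lemma deg_hyperharmonic_eq_deg_harmonic:
  assumes "lam \<noteq> 0" and "r \<ge> 1" and nz: "((real r - 1 - lam) gchoose (r - 1)) \<noteq> 0"
  shows "deg_hyperharmonic lam r k =
    real ((k + r - 1) choose (r - 1)) / ((real r - 1 - lam) gchoose (r - 1))
      * (deg_harmonic lam (k + r - 1) - deg_harmonic lam (r - 1))"
proof -
  obtain s where r: "r = Suc s" using assms(2) by (cases r) auto
  show ?thesis
    using deg_hyperharmonic_closed_form[OF assms(1), of s k] nz by (simp add: r field_simps)
qed

theorem theorem5:
  fixes lam y :: real and n r :: nat
  assumes "lam \<noteq> 0" and "n \<ge> 1" and "r \<ge> 1"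
  shows
    "deg_hyperharmonic_Fubini_poly lam r n y =
       (\<Sum>k=1..n. deg_hyperharmonic lam r k * y ^ k * fact k * deg_Stirling2 lam n k)
     \<and> (((real r - 1 - lam) gchoose (r - 1)) \<noteq> 0 \<longrightarrow>
       (\<Sum>k=1..n. deg_hyperharmonic lam r k * y ^ k * fact k * deg_Stirling2 lam n k) =
       (\<Sum>k=1..n. real ((k + r - 1) choose (r - 1)) / ((real r - 1 - lam) gchoose (r - 1))
          * (deg_harmonic lam (k + r - 1) - deg_harmonic lam (r - 1))
          * fact k * deg_Stirling2 lam n k * y ^ k))
     \<and> deg_hyperharmonic_Fubini lam r n =
       (\<Sum>k=1..n. deg_hyperharmonic lam r k * fact k * deg_Stirling2 lam n k)
     \<and> (((real r - 1 - lam) gchoose (r - 1)) \<noteq> 0 \<longrightarrow>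
       (\<Sum>k=1..n. deg_hyperharmonic lam r k * fact k * deg_Stirling2 lam n k) =
       (\<Sum>k=1..n. real ((k + r - 1) choose (r - 1)) / ((real r - 1 - lam) gchoose (r - 1))
          * (deg_harmonic lam (k + r - 1) - deg_harmonic lam (r - 1))
          * fact k * deg_Stirling2 lam n k))"
proof -
  have fubini: "deg_hyperharmonic_Fubini_poly lam r n x =
      (\<Sum>k=1..n. deg_hyperharmonic lam r k * x ^ k * fact k * deg_Stirling2 lam n k)" for x
    by (rule deg_hyperharmonic_Fubini_poly_eq_sum[OF assms(1,3)])
  show ?thesis
  proof (intro conjI impI)
    assume "((real r - 1 - lam) gchoose (r - 1)) \<noteq> 0"
    note closed = deg_hyperharmonic_eq_deg_harmonic[OF assms(1,3) this]
    show "(\<Sum>k=1..n. deg_hyperharmonic lam r k * y ^ k * fact k * deg_Stirling2 lam n k) =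
       (\<Sum>k=1..n. real ((k + r - 1) choose (r - 1)) / ((real r - 1 - lam) gchoose (r - 1))
          * (deg_harmonic lam (k + r - 1) - deg_harmonic lam (r - 1))
          * fact k * deg_Stirling2 lam n k * y ^ k)"
      unfolding closed by (simp only: mult_ac)
    show "(\<Sum>k=1..n. deg_hyperharmonic lam r k * fact k * deg_Stirling2 lam n k) =
       (\<Sum>k=1..n. real ((k + r - 1) choose (r - 1)) / ((real r - 1 - lam) gchoose (r - 1))
          * (deg_harmonic lam (k + r - 1) - deg_harmonic lam (r - 1))
          * fact k * deg_Stirling2 lam n k)"
      unfolding closed ..
  qed (use fubini[of y] fubini[of 1] in \<open>simp_all add: deg_hyperharmonic_Fubini_def\<close>)
qed

end
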